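(* Let $\mathcal H$ be a separable Banach space, $\Psi:\mathcal H\to\mathbb R$ measurable, $\mathcal K$ a Markov transition kernel on $\mathcal H$, $\lambda$ a Radon probability measure on $\mathcal H$, and let $\mathcal P$ be the RCAR-MH kernel built from $(\Psi,\mathcal K,\lambda)$ (see context). Let $q\ge0$. Assume: (1a) for every $R>0$ there is $M_1(R)\ge0$ with $\Psi(u)\le M_1(R)$ for all $u\in B_R(0)$; (1b) there exist $M_2,M_3\ge0$ with $\Psi(u)\ge M_3-M_2\log(1+\|u\|^q)$ for all $u\in\mathcal H$; (1d) there exists $L>0$ with $|\Psi(u)-\Psi(v)|\le L(1\vee\|u\|^q\vee\|v\|^q)\|u-v\|$ for all $u,v\in\mathcal H$; (2a) with $\zeta_u\sim\mathcal K(u,\cdot)$, $\|\zeta_u\|<\|u\|$ a.s. for every $u\ne0$, and $\zeta_0=0$ a.s.; (2c) for all $u,v\in\mathcal H$ there is a coupling $\varpi_{u,v}$ of $\mathcal K(u,\cdot)$ and $\mathcal K(v,\cdot)$ such that, for $(\zeta_u,\zeta_v)\sim\varpi_{u,v}$, $\|\zeta_u-\zeta_v\|<\|u-v\|$ a.s. if $u\neq v$ (and $\zeta_u=\zeta_v$ a.s. if $u=v$), and there is a uniform constant $\beta_c\in(0,1)$ with $\sup_{u\ne v}\|u-v\|^{-1}\int\|\zeta_u-\zeta_v\|\,\varpi_{u,v}(d\zeta_u,d\zeta_v)\le\beta_c$; (3) $\int\|\xi\|^q\lambda(d\xi)<\infty$. Then $\mathcal P$ is Feller: $\mathcal P\varphi$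 is continuous on $\mathcal H$ for every bounded continuous $\varphi:\mathcal H\to\mathbb R$.
   Context: $B_R(v)$ denotes the closed ball of radius $R$ centered at $v$. Given $(\Psi,\mathcal K,\lambda)$, put $\mathcal Q(u,\cdot):=\mathcal K(u,\cdot)*\lambda$ (the law of $\zeta_u+\xi$ with independent $\zeta_u\sim\mathcal K(u,\cdot)$, $\xi\sim\lambda$) and $\alpha(u,v):=1\wedge\exp(\Psi(u)-\Psi(v))$. The RCAR-MH kernel is $$\mathcal P(u,dv):=\alpha(u,v)\,\mathcal Q(u,dv)+\delta_u(dv)\int_{\mathcal H}(1-\alpha(u,w))\,\mathcal Q(u,dw),$$ and $(\mathcal P\varphi)(u)=\int_{\mathcal H}\varphi(v)\,\mathcal P(u,dv)$. *)

theory Defs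
  imports "HOL-Probability.Probability"
begin

text \<open>
  The library's \<open>powr\<close> has \<open>0 powr 0 = 0\<close>; here \<open>0\<close> to the power \<open>0\<close> is \<open>1\<close>,
  so that the constant function \<open>1\<close> is obtained for exponent \<open>0\<close>.
\<close>

definition rpow :: "real \<Rightarrow> real \<Rightarrow> real" where
  "rpow x q = (if q = 0 then 1 else x powr q)"

definition radon_prob :: "'a::topological_space measure \<Rightarrow> bool" where
  "radon_prob M \<longleftrightarrow> prob_space M \<and> sets M = sets borel \<and>
     (\<forall>B\<in>sets borel. emeasure M B = (SUP C\<in>{C. C \<subseteq> B \<and> compact C}. emeasure M C))"

text \<open>
  The library's convolution of measures is restricted to ordered Euclidean spaces.
\<close>

definition conv :: "'a::real_normed_vector measure \<Rightarrow> 'a measure \<Rightarrow> 'a measure" where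
  "conv M N = distr (M \<Otimes>\<^sub>M N) borel (\<lambda>(x, y). x + y)"

definition coupling :: "('a::topological_space \<times> 'a) measure \<Rightarrow> 'a measure \<Rightarrow> 'a measure \<Rightarrow> bool" where
  "coupling W M N \<longleftrightarrow> prob_space W \<and> sets W = sets (borel \<Otimes>\<^sub>M borel) \<and>
     distr W borel fst = M \<and> distr W borel snd = N"

definition proposal ::
  "('a::real_normed_vector \<Rightarrow> 'a measure) \<Rightarrow> 'a measure \<Rightarrow> 'a \<Rightarrow> 'a measure" where
  "proposal K \<Lambda> u = conv (K u) \<Lambda>"

definition accept :: "('a \<Rightarrow> real) \<Rightarrow> 'a \<Rightarrow> 'a \<Rightarrow> real" where
  "accept \<Psi> u v = min 1 (exp (\<Psi> u - \<Psi> v))"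

text \<open>
  \<open>measure_of\<close> returns the null measure if the given set function is not a measure; that
  this does not happen here is \<open>emeasure_rcar_mh\<close> below.
\<close>

definition rcar_mh ::
  "('a::real_normed_vector \<Rightarrow> real) \<Rightarrow> ('a \<Rightarrow> 'a measure) \<Rightarrow> 'a measure \<Rightarrow> 'a \<Rightarrow> 'a measure" where
  "rcar_mh \<Psi> K \<Lambda> u = measure_of UNIV (sets borel)
     (\<lambda>A. (\<integral>\<^sup>+v\<in>A. ennreal (accept \<Psi> u v) \<partial>proposal K \<Lambda> u)
        + emeasure (return borel u) A * (\<integral>\<^sup>+w. ennreal (1 - accept \<Psi> u w) \<partial>proposal K \<Lambda> u))"

definition feller :: "('a::topological_space \<Rightarrow> 'a measure) \<Rightarrow> bool" where
  "feller P \<longleftrightarrow> (\<forall>\<phi>::'a \<Rightarrow> real. continuous_on UNIV \<phi> \<and> bounded (range \<phi>) \<longrightarrow>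
     continuous_on UNIV (\<lambda>u. \<integral>v. \<phi> v \<partial>P u))"

lemma sets_proposal [simp, measurable_cong]: "sets (proposal K \<Lambda> u) = sets borel"
  and space_proposal [simp]: "space (proposal K \<Lambda> u) = UNIV"
  by (simp_all add: proposal_def conv_def)

lemma sets_rcar_mh [simp, measurable_cong]: "sets (rcar_mh \<Psi> K \<Lambda> u) = sets borel"
  and space_rcar_mh [simp]: "space (rcar_mh \<Psi> K \<Lambda> u) = UNIV"
  using sets.sigma_sets_eq[of "borel :: 'a measure"] by (simp_all add: rcar_mh_def)

lemma accept_bounds: "0 \<le> accept \<Psi> u v" "accept \<Psi> u v \<le> 1"
  by (simp_all add: accept_def)

lemma measurable_accept [measurable]:
  assumes [measurable]: "\<Psi> \<in> borel_measurable M"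
  shows "(\<lambda>v. accept \<Psi> u v) \<in> borel_measurable M"
  unfolding accept_def by (intro borel_measurable_min) measurable

lemma emeasure_rcar_mh:
  fixes \<Psi> :: "'a::{banach, second_countable_topology} \<Rightarrow> real"
  assumes [measurable]: "\<Psi> \<in> borel_measurable borel" and A: "A \<in> sets borel"
  shows "emeasure (rcar_mh \<Psi> K \<Lambda> u) A =
    (\<integral>\<^sup>+v\<in>A. ennreal (accept \<Psi> u v) \<partial>proposal K \<Lambda> u)
      + emeasure (return borel u) A * (\<integral>\<^sup>+w. ennreal (1 - accept \<Psi> u w) \<partial>proposal K \<Lambda> u)"
proof -
  let ?Q = "proposal K \<Lambda> u"
  let ?D = "density ?Q (\<lambda>v. ennreal (accept \<Psi> u v))"
  let ?c = "\<integral>\<^sup>+w. ennreal (1 - accept \<Psi> u w) \<partial>?Q"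
  let ?\<mu> = "\<lambda>A. (\<integral>\<^sup>+v\<in>A. ennreal (accept \<Psi> u v) \<partial>?Q) + emeasure (return borel u) A * ?c"
  have D: "(\<integral>\<^sup>+v\<in>A. ennreal (accept \<Psi> u v) \<partial>?Q) = emeasure ?D A" if "A \<in> sets borel" for A
    using that by (subst emeasure_density) auto
  have "countably_additive (sets borel) ?\<mu>"
  proof (rule countably_additiveI)
    fix B :: "nat \<Rightarrow> 'a set"
    assume B: "range B \<subseteq> sets borel" "disjoint_family B" "(\<Union>i. B i) \<in> sets borel"
    have "(\<Sum>i. emeasure ?D (B i)) = emeasure ?D (\<Union>i. B i)"
      using B by (intro suminf_emeasure) auto
    moreover have "(\<Sum>i. emeasure (return borel u) (B i)) = emeasure (return borel u) (\<Union>i. B i)"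
      using B by (intro suminf_emeasure) auto
    moreover have "B i \<in> sets borel" for i using B by auto
    ultimately show "(\<Sum>i. ?\<mu> (B i)) = ?\<mu> (\<Union>i. B i)"
      using B(3) by (simp add: D suminf_add[symmetric] ennreal_suminf_multc)
  qed
  moreover have "positive (sets borel) ?\<mu>"
    by (simp add: positive_def)
  ultimately show ?thesis
    using A sets.sigma_algebra_axioms[of "borel :: 'a measure"]
    unfolding rcar_mh_def by (intro emeasure_measure_of_sigma) auto
qed

lemma prob_space_rcar_mh:
  fixes \<Psi> :: "'a::{banach, second_countable_topology} \<Rightarrow> real"
  assumes [measurable]: "\<Psi> \<in> borel_measurable borel"
    and K: "K \<in> borel \<rightarrow>\<^sub>M prob_algebra borel"
    and \<Lambda>: "prob_space \<Lambda>" "sets \<Lambda> = sets borel"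
  shows "prob_space (rcar_mh \<Psi> K \<Lambda> u)"
proof -
  have Ku: "prob_space (K u)" "sets (K u) = sets borel"
    using measurable_space[OF K, of u] by (auto simp: space_prob_algebra)
  interpret K: prob_space "K u" by fact
  interpret L: prob_space \<Lambda> by fact
  interpret KL: pair_prob_space "K u" \<Lambda> ..
  have "(\<lambda>(x, y). x + y) \<in> K u \<Otimes>\<^sub>M \<Lambda> \<rightarrow>\<^sub>M borel"
    using Ku(2) \<Lambda>(2) by (simp cong: measurable_cong_sets)
  then interpret Q: prob_space "proposal K \<Lambda> u"
    unfolding proposal_def conv_def by (rule KL.prob_space_distr)
  have "emeasure (rcar_mh \<Psi> K \<Lambda> u) UNIV =
    (\<integral>\<^sup>+v. ennreal (accept \<Psi> u v) + ennreal (1 - accept \<Psi> u v) \<partial>proposal K \<Lambda> u)"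
    by (simp add: emeasure_rcar_mh nn_integral_add)
  also have "\<dots> = (\<integral>\<^sup>+v. 1 \<partial>proposal K \<Lambda> u)"
    by (intro nn_integral_cong) (simp add: ennreal_plus[symmetric] accept_bounds del: ennreal_plus)
  finally show ?thesis
    using Q.emeasure_space_1 by (intro prob_spaceI) simp
qed

end

theory Submission
  imports Defs
begin

text \<open>
  The proposal law depends on its starting point continuously enough to integrate test functions
  that themselves move with the starting point. Integrating \<open>\<phi>\<close> against the
  Metropolis-Hastings kernel splits into an accepted and a rejected part
  (\<open>integral_rcar_mh\<close>),
  \<open>(P \<phi>)(u) = \<integral> \<alpha>(u,v) \<phi>(v) Q(u,dv) + \<phi>(u) (1 - \<integral> \<alpha>(u,w) Q(u,dw))\<close>,
  so everything reduces to continuity of \<open>u \<mapsto> \<integral> f(u,v) Q(u,dv)\<close> for a bounded, jointly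
  continuous \<open>f\<close>, used once with \<open>f(u,v) = \<alpha>(u,v) \<phi>(v)\<close> and once with \<open>f = \<alpha>\<close>
  (\<open>continuous_on_integral_proposal\<close>). Joint continuity of \<open>\<alpha>\<close> comes from that of \<open>\<Psi>\<close>,
  which is Lipschitz on bounded sets.

  Averaging \<open>f(u, x + \<xi>)\<close> over the noise \<open>\<xi>\<close> gives a function \<open>g(u,x)\<close> that is again
  bounded and jointly continuous, by dominated convergence; it remains to integrate
  \<open>g(u,\<cdot>)\<close> against \<open>K(u,\<cdot>)\<close>. The coupling puts \<open>\<zeta>\<^sub>u\<close> and \<open>\<zeta>\<^sub>v\<close> within the distance of
  \<open>u\<close> and \<open>v\<close> almost surely. Hence \<open>g(u,\<zeta>\<^sub>u)\<close> and \<open>g(v,\<zeta>\<^sub>v)\<close> can differ by more than a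
  given tolerance only if \<open>g\<close> oscillates by that much, at that scale, near
  \<open>(u,\<zeta>\<^sub>u)\<close>. As the scale shrinks, the set of points \<open>x\<close> where this happens decreases
  to the empty set, so its mass under the single measure \<open>K(u,\<cdot>)\<close> vanishes
  (\<open>continuous_on_integral_nonexpansive_coupling\<close>).
\<close>

section \<open>Continuity of integrals along non-expansively coupled measures\<close>

text \<open>
  An integrand that is merely continuous need not be uniformly continuous, and without local
  compactness it need not be uniformly continuous even on balls. The coupling alone therefore
  does not make \<open>g u x - g v y\<close> uniformly small; instead, the exceptional \<open>x\<close> are controlled through
  their measure. They form a set in the first coordinate,
  whose law under the coupling is \<open>K u\<close> for every \<open>v\<close>, so the estimate is uniform in \<open>v\<close>.
\<close>

lemma continuous_on_integral_nonexpansive_coupling: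
  fixes K :: "'a::{metric_space, second_countable_topology} \<Rightarrow> 'a measure"
    and g :: "'a \<Rightarrow> 'a \<Rightarrow> real"
  assumes W: "\<And>u v. coupling (W u v) (K u) (K v)"
    and close: "\<And>u v. AE (x, y) in W u v. dist x y \<le> dist u v"
    and cont: "continuous_on UNIV (\<lambda>(u, x). g u x)"
    and bound: "\<And>u x. \<bar>g u x\<bar> \<le> B"
  shows "continuous_on UNIV (\<lambda>u. \<integral>x. g u x \<partial>K u)"
proof (unfold continuous_on_iff, intro ballI allI impI)
  fix u :: 'a and e :: real
  assume "0 < e"
  have cont_g: "continuous_on UNIV (g v)" for v
    using continuous_on_compose2[OF cont, of UNIV "\<lambda>x. (v, x)"]
    by (simp add: continuous_on_Pair)
  then have [measurable]: "g v \<in> borel_measurable borel" for v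
    by (rule borel_measurable_continuous_onI)
  have W': "prob_space (W v w)" "sets (W v w) = sets (borel \<Otimes>\<^sub>M borel)"
    "distr (W v w) borel fst = K v" "distr (W v w) borel snd = K w" for v w
    using W[of v w] by (auto simp: coupling_def)
  have fst_W[measurable]: "fst \<in> W v w \<rightarrow>\<^sub>M borel"
    and snd_W[measurable]: "snd \<in> W v w \<rightarrow>\<^sub>M borel" for v w
    using W'(2)[of v w] by (simp_all cong: measurable_cong_sets)
  interpret Ku: prob_space "K u"
    using prob_space.prob_space_distr[OF W'(1) fst_W, of u u] W'(3)[of u u] by simp
  have sets_Ku: "sets (K u) = sets borel" using W'(3)[of u u] by (metis sets_distr)
  (* E n collects the points x near which g jumps by more than e / 2 at scale r n. It is a union
     of open sets, so it is measurable although it is a projection. *)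
  define r where "r n = 1 / real (Suc n)" for n
  define E where "E n = {x. \<exists>v y. dist u v < r n \<and> dist x y < r n \<and> e / 2 < \<bar>g u x - g v y\<bar>}" for n
  have "open (E n)" for n
  proof -
    have "E n = (\<Union>v\<in>{v. dist u v < r n}. \<Union>y. {x. dist x y < r n} \<inter> {x. e / 2 < \<bar>g u x - g v y\<bar>})"
      by (auto simp: E_def)
    moreover have "open {x. e / 2 < \<bar>g u x - g v y\<bar>}" for v y
      by (intro open_Collect_less continuous_intros cont_g)
    moreover have "open {x. dist x y < r n}" for y :: 'a
      by (intro open_Collect_less continuous_intros)
    ultimately show ?thesis by (simp only:) (intro open_UN ballI open_Int)
  qed
  then have E_sets: "E n \<in> sets borel" for n by (rule borel_open)
  have "decseq E"
  proof (rule decseq_SucI)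
    fix n
    have "r (Suc n) \<le> r n" by (simp add: r_def frac_le)
    then show "E (Suc n) \<subseteq> E n" unfolding E_def by (smt (verit) Collect_mono)
  qed
  (* A point in every E n would contradict continuity of g at (u, x). *)
  have "(\<Inter>n. E n) = {}"
  proof (rule ccontr)
    assume "(\<Inter>n. E n) \<noteq> {}"
    then obtain x where x: "\<And>n. x \<in> E n" by blast
    obtain d where d: "0 < d"
      "\<And>p. dist p (u, x) < d \<Longrightarrow> dist (case p of (v, y) \<Rightarrow> g v y) (g u x) < e / 2"
      using cont \<open>0 < e\<close> unfolding continuous_on_iff by (metis UNIV_I case_prod_conv half_gt_zero)
    obtain n where n: "r n < d / 2"
      using reals_Archimedean[of "d / 2"] d(1) by (auto simp: r_def inverse_eq_divide)
    obtain v y where vy: "dist u v < r n" "dist x y < r n" "e / 2 < \<bar>g u x - g v y\<bar>"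
      using x[of n] by (auto simp: E_def)
    have "dist (v, y) (u, x) \<le> dist v u + dist y x"
      unfolding dist_Pair_Pair by (rule sqrt_sum_squares_le_sum) auto
    also have "\<dots> < d" using vy n by (simp add: dist_commute)
    finally show False using d(2)[of "(v, y)"] vy(3) by (simp add: dist_real_def abs_minus_commute)
  qed
  then have "(\<lambda>n. measure (K u) (E n)) \<longlonglongrightarrow> 0"
    using Ku.finite_Lim_measure_decseq[of E] E_sets sets_Ku \<open>decseq E\<close> by auto
  then have "(\<lambda>n. 2 * B * measure (K u) (E n)) \<longlonglongrightarrow> 0"
    using tendsto_mult_left[of _ 0 sequentially "2 * B"] by simp
  then have "eventually (\<lambda>n. 2 * B * measure (K u) (E n) < e / 2) sequentially"
    using \<open>0 < e\<close> by (intro order_tendstoD) auto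
  then obtain n where n: "2 * B * measure (K u) (E n) < e / 2"
    by (auto simp: eventually_sequentially)
  (* Transport both integrals to the coupling: off E n the integrands differ by at most e / 2,
     on E n by at most 2 * B. *)
  have "dist (\<integral>x. g v x \<partial>K v) (\<integral>x. g u x \<partial>K u) < e" if "dist v u < r n" for v
  proof -
    interpret W: prob_space "W u v" by (rule W'(1))
    have int[simp]: "integrable (W u v) (\<lambda>p. g u (fst p))" "integrable (W u v) (\<lambda>p. g v (snd p))"
      using bound by (auto intro!: W.integrable_const_bound[of _ B])
    have "E n \<in> sets borel" by (rule E_sets)
    then have "(\<lambda>p. indicator (E n) (fst p) :: real) \<in> borel_measurable (W u v)"
      by measurable
    then have int_E[simp]: "integrable (W u v) (\<lambda>p. indicator (E n) (fst p) :: real)"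
      by (intro W.integrable_const_bound[of _ 1]) (auto split: split_indicator)
    have "(\<integral>x. g u x \<partial>K u) = (\<integral>p. g u (fst p) \<partial>W u v)"
      by (subst W'(3)[of u v, symmetric], subst integral_distr) auto
    moreover have "(\<integral>x. g v x \<partial>K v) = (\<integral>p. g v (snd p) \<partial>W u v)"
      by (subst W'(4)[of u v, symmetric], subst integral_distr) auto
    ultimately have "dist (\<integral>x. g v x \<partial>K v) (\<integral>x. g u x \<partial>K u)
        = \<bar>\<integral>p. g u (fst p) - g v (snd p) \<partial>W u v\<bar>"
      by (simp add: dist_real_def abs_minus_commute)
    also have "\<dots> \<le> (\<integral>p. \<bar>g u (fst p) - g v (snd p)\<bar> \<partial>W u v)"
      by (rule integral_abs_bound)
    also have "\<dots> \<le> (\<integral>p. e / 2 + 2 * B * indicator (E n) (fst p) \<partial>W u v)"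
    proof (rule integral_mono_AE)
      show "AE p in W u v. \<bar>g u (fst p) - g v (snd p)\<bar> \<le> e / 2 + 2 * B * indicator (E n) (fst p)"
        using close[of u v]
      proof (rule AE_mp, intro AE_I2 impI)
        fix p :: "'a \<times> 'a"
        assume p: "case p of (x, y) \<Rightarrow> dist x y \<le> dist u v"
        show "\<bar>g u (fst p) - g v (snd p)\<bar> \<le> e / 2 + 2 * B * indicator (E n) (fst p)"
        proof (cases "fst p \<in> E n")
          case True
          then show ?thesis using bound[of u "fst p"] bound[of v "snd p"] \<open>0 < e\<close> by simp
        next
          case False
          moreover have "dist u v < r n" "dist (fst p) (snd p) < r n"
            using p that by (auto simp: dist_commute case_prod_beta)
          ultimately have "\<bar>g u (fst p) - g v (snd p)\<bar> \<le> e / 2"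
            unfolding E_def mem_Collect_eq not_less[symmetric] by blast
          with False show ?thesis by simp
        qed
      qed
    qed auto
    also have "\<dots> = e / 2 + 2 * B * (\<integral>p. indicator (E n) (fst p) \<partial>W u v)"
      by (simp add: W.prob_space)
    also have "(\<integral>p. indicator (E n) (fst p) \<partial>W u v) = (\<integral>x. (indicator (E n) x :: real) \<partial>K u)"
      by (subst W'(3)[of u v, symmetric], subst integral_distr) (auto intro: borel_measurable_indicator E_sets)
    also have "(\<integral>x. (indicator (E n) x :: real) \<partial>K u) = measure (K u) (E n)"
      using E_sets sets_Ku sets_eq_imp_space_eq[OF sets_Ku] by simp
    also have "e / 2 + 2 * B * measure (K u) (E n) < e" using n by simp
    finally show ?thesis .
  qed
  moreover have "0 < r n" by (simp add: r_def)
  ultimately show "\<exists>d>0. \<forall>v\<in>UNIV. dist v u < d \<longrightarrow>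
      dist (\<integral>x. g v x \<partial>K v) (\<integral>x. g u x \<partial>K u) < e"
    by blast
qed

section \<open>Integration against the proposal and the Metropolis-Hastings kernel\<close>

lemma continuous_on_integral_translate:
  fixes f :: "'a::real_normed_vector \<Rightarrow> 'a \<Rightarrow> real"
  assumes "finite_measure M" and sets_M: "sets M = sets borel"
    and cont: "continuous_on UNIV (\<lambda>(u, z). f u z)"
    and bound: "\<And>u z. \<bar>f u z\<bar> \<le> B"
  shows "continuous_on UNIV (\<lambda>(u, x). \<integral>\<xi>. f u (x + \<xi>) \<partial>M)"
proof -
  interpret finite_measure M by fact
  have meas: "(\<lambda>\<xi>. f u (x + \<xi>)) \<in> borel_measurable M" for u x
  proof -
    have "continuous_on UNIV (\<lambda>\<xi>. f u (x + \<xi>))"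
      using continuous_on_compose2[OF cont, of UNIV "\<lambda>\<xi>. (u, x + \<xi>)"]
      by (simp add: continuous_on_Pair continuous_on_add)
    then show ?thesis
      using borel_measurable_continuous_onI sets_M by (metis measurable_cong_sets)
  qed
  have "(\<lambda>n. \<integral>\<xi>. f (fst (p n)) (snd (p n) + \<xi>) \<partial>M) \<longlonglongrightarrow> (\<integral>\<xi>. f (fst a) (snd a + \<xi>) \<partial>M)"
    if p: "p \<longlonglongrightarrow> a" for p :: "nat \<Rightarrow> 'a \<times> 'a" and a
  proof (rule integral_dominated_convergence[where w = "\<lambda>_. B"])
    show "AE \<xi> in M. (\<lambda>n. f (fst (p n)) (snd (p n) + \<xi>)) \<longlonglongrightarrow> f (fst a) (snd a + \<xi>)"
    proof (rule AE_I2)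
      fix \<xi>
      have "(\<lambda>n. (fst (p n), snd (p n) + \<xi>)) \<longlonglongrightarrow> (fst a, snd a + \<xi>)"
        by (intro tendsto_intros p)
      from continuous_on_tendsto_compose[OF cont this]
      show "(\<lambda>n. f (fst (p n)) (snd (p n) + \<xi>)) \<longlonglongrightarrow> f (fst a) (snd a + \<xi>)" by simp
    qed
  qed (auto intro: meas simp: bound)
  then show ?thesis
    by (auto simp: continuous_on_sequentially comp_def case_prod_beta)
qed

lemma integral_conv:
  fixes f :: "'a::{real_normed_vector, second_countable_topology} \<Rightarrow> real"
  assumes "prob_space M" "prob_space N"
    and sets [measurable_cong]: "sets M = sets borel" "sets N = sets borel"
    and [measurable]: "f \<in> borel_measurable borel"
    and bound: "\<And>z. \<bar>f z\<bar> \<le> B"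
  shows "(\<integral>z. f z \<partial>conv M N) = (\<integral>x. \<integral>\<xi>. f (x + \<xi>) \<partial>N \<partial>M)"
proof -
  interpret M: prob_space M by fact
  interpret N: prob_space N by fact
  interpret MN: pair_prob_space M N ..
  have "(\<integral>z. f z \<partial>conv M N) = (\<integral>p. f (case p of (x, y) \<Rightarrow> x + y) \<partial>(M \<Otimes>\<^sub>M N))"
    unfolding conv_def by (rule integral_distr) auto
  also have "\<dots> = (\<integral>(x, \<xi>). f (x + \<xi>) \<partial>(M \<Otimes>\<^sub>M N))"
    by (intro Bochner_Integration.integral_cong) auto
  also have "\<dots> = (\<integral>x. \<integral>\<xi>. f (x + \<xi>) \<partial>N \<partial>M)"
    using bound by (intro MN.integral_fst[symmetric] MN.integrable_const_bound[of _ B]) auto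
  finally show ?thesis .
qed

lemma prob_space_conv:
  fixes M N :: "'a::{real_normed_vector, second_countable_topology} measure"
  assumes "prob_space M" "prob_space N"
    and [measurable_cong]: "sets M = sets borel" "sets N = sets borel"
  shows "prob_space (conv M N)"
proof -
  interpret M: prob_space M by fact
  interpret N: prob_space N by fact
  interpret MN: pair_prob_space M N ..
  show ?thesis unfolding conv_def by (rule MN.prob_space_distr) measurable
qed

text \<open>
  The kernel is given by its values on Borel sets, which is the case of indicator functions; both
  sides are linear and continuous along increasing sequences.
\<close>

lemma nn_integral_rcar_mh:
  fixes \<Psi> :: "'a::{banach, second_countable_topology} \<Rightarrow> real"
  assumes [measurable]: "\<Psi> \<in> borel_measurable borel" and f: "f \<in> borel_measurable borel"
  shows "(\<integral>\<^sup>+v. f v \<partial>rcar_mh \<Psi> K \<Lambda> u) = (\<integral>\<^sup>+v. ennreal (accept \<Psi> u v) * f v \<partial>proposal K \<Lambda> u)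
    + f u * (\<integral>\<^sup>+w. ennreal (1 - accept \<Psi> u w) \<partial>proposal K \<Lambda> u)"
  using f
proof induction
  case (cong f g)
  then show ?case by (simp cong: nn_integral_cong)
next
  case (set A)
  then show ?case by (simp add: emeasure_rcar_mh)
next
  case (mult f c)
  then show ?case
    by (simp add: nn_integral_cmult distrib_left mult.assoc mult.left_commute[of _ c])
next
  case (add f g)
  then show ?case by (simp add: nn_integral_add distrib_left distrib_right ac_simps)
next
  case (seq F)
  note [measurable] = seq(1)
  let ?Q = "proposal K \<Lambda> u"
  let ?c = "\<integral>\<^sup>+w. ennreal (1 - accept \<Psi> u w) \<partial>?Q"
  have Sup_F: "(SUP i. F i) = (\<lambda>v. SUP i. F i v)"
    by (rule ext) (rule SUP_apply)
  have mono: "incseq (\<lambda>i v. ennreal (accept \<Psi> u v) * F i v)"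
    using \<open>incseq F\<close> by (auto simp: incseq_def le_fun_def intro!: mult_left_mono)
  have "(\<integral>\<^sup>+v. (SUP i. F i) v \<partial>rcar_mh \<Psi> K \<Lambda> u) = (SUP i. \<integral>\<^sup>+v. F i v \<partial>rcar_mh \<Psi> K \<Lambda> u)"
    using seq(3) unfolding Sup_F by (intro nn_integral_monotone_convergence_SUP) auto
  also have "\<dots> = (SUP i. (\<integral>\<^sup>+v. ennreal (accept \<Psi> u v) * F i v \<partial>?Q) + F i u * ?c)"
    using seq by simp
  also have "\<dots> = (SUP i. \<integral>\<^sup>+v. ennreal (accept \<Psi> u v) * F i v \<partial>?Q) + (SUP i. F i u * ?c)"
    using \<open>incseq F\<close> mono
    by (intro ennreal_SUP_add)
      (auto simp: incseq_def le_fun_def intro!: mult_right_mono nn_integral_mono)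
  also have "(SUP i. \<integral>\<^sup>+v. ennreal (accept \<Psi> u v) * F i v \<partial>?Q)
      = (\<integral>\<^sup>+v. (SUP i. ennreal (accept \<Psi> u v) * F i v) \<partial>?Q)"
    using mono by (intro nn_integral_monotone_convergence_SUP[symmetric]) auto
  finally show ?case
    by (simp add: SUP_mult_left_ennreal SUP_mult_right_ennreal image_comp)
qed

text \<open>
  Shifting \<open>\<phi>\<close> by its bound \<open>B\<close> makes it nonnegative, where the formula for nonnegative integrals
  applies; as both sides have total mass one, the shift cancels.
\<close>

lemma integral_rcar_mh:
  fixes \<Psi> \<phi> :: "'a::{banach, second_countable_topology} \<Rightarrow> real"
  assumes [measurable]: "\<Psi> \<in> borel_measurable borel" "\<phi> \<in> borel_measurable borel"
    and Q: "prob_space (proposal K \<Lambda> u)" and P: "prob_space (rcar_mh \<Psi> K \<Lambda> u)"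
    and bound: "\<And>v. \<bar>\<phi> v\<bar> \<le> B"
  shows "(\<integral>v. \<phi> v \<partial>rcar_mh \<Psi> K \<Lambda> u) = (\<integral>v. accept \<Psi> u v * \<phi> v \<partial>proposal K \<Lambda> u)
    + \<phi> u * (1 - (\<integral>w. accept \<Psi> u w \<partial>proposal K \<Lambda> u))"
proof -
  let ?Q = "proposal K \<Lambda> u" and ?P = "rcar_mh \<Psi> K \<Lambda> u"
  interpret Q: prob_space ?Q by fact
  interpret P: prob_space ?P by fact
  have B: "0 \<le> \<phi> v + B" for v
    using bound[of v] by linarith
  have int_P: "integrable ?P \<phi>"
    using bound by (auto intro!: P.integrable_const_bound[of _ B])
  have int_a: "integrable ?Q (accept \<Psi> u)"
    by (auto intro!: Q.integrable_const_bound[of _ 1] simp: accept_bounds)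
  have int_Q: "integrable ?Q (\<lambda>v. accept \<Psi> u v * \<phi> v)"
  proof (rule Q.integrable_const_bound[of _ B])
    have "\<bar>accept \<Psi> u v * \<phi> v\<bar> \<le> 1 * B" for v
      unfolding abs_mult using bound by (intro mult_mono) (auto simp: accept_bounds)
    then show "AE v in ?Q. norm (accept \<Psi> u v * \<phi> v) \<le> B" by simp
  qed simp
  have int_QB: "integrable ?Q (\<lambda>v. accept \<Psi> u v * (\<phi> v + B))"
    using int_Q int_a by (simp add: distrib_left)
  have "ennreal (\<integral>v. \<phi> v + B \<partial>?P) = (\<integral>\<^sup>+v. ennreal (\<phi> v + B) \<partial>?P)"
    using B int_P by (intro nn_integral_eq_integral[symmetric]) auto
  also have "\<dots> = (\<integral>\<^sup>+v. ennreal (accept \<Psi> u v * (\<phi> v + B)) \<partial>?Q)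
      + ennreal (\<phi> u + B) * (\<integral>\<^sup>+w. ennreal (1 - accept \<Psi> u w) \<partial>?Q)"
    using B by (subst nn_integral_rcar_mh) (auto simp: ennreal_mult accept_bounds)
  also have "(\<integral>\<^sup>+v. ennreal (accept \<Psi> u v * (\<phi> v + B)) \<partial>?Q)
      = ennreal (\<integral>v. accept \<Psi> u v * (\<phi> v + B) \<partial>?Q)"
    using B int_QB by (intro nn_integral_eq_integral) (auto simp: accept_bounds)
  also have "(\<integral>\<^sup>+w. ennreal (1 - accept \<Psi> u w) \<partial>?Q) = ennreal (\<integral>w. 1 - accept \<Psi> u w \<partial>?Q)"
    using int_a by (intro nn_integral_eq_integral) (auto simp: accept_bounds)
  also have "ennreal (\<integral>v. accept \<Psi> u v * (\<phi> v + B) \<partial>?Q)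
        + ennreal (\<phi> u + B) * ennreal (\<integral>w. 1 - accept \<Psi> u w \<partial>?Q)
      = ennreal ((\<integral>v. accept \<Psi> u v * (\<phi> v + B) \<partial>?Q) + (\<phi> u + B) * (\<integral>w. 1 - accept \<Psi> u w \<partial>?Q))"
    using B by (simp add: ennreal_mult integral_nonneg_AE accept_bounds)
  finally have "(\<integral>v. \<phi> v + B \<partial>?P)
      = (\<integral>v. accept \<Psi> u v * (\<phi> v + B) \<partial>?Q) + (\<phi> u + B) * (\<integral>w. 1 - accept \<Psi> u w \<partial>?Q)"
    by (subst (asm) ennreal_inj)
      (auto intro!: integral_nonneg_AE add_nonneg_nonneg mult_nonneg_nonneg simp: B accept_bounds)
  then show ?thesis
    using int_P int_Q int_a Q.prob_space P.prob_space
    by (simp add: algebra_simps)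
qed

section \<open>The Feller property\<close>

text \<open>
  On the unit ball around \<open>u\<close> the growth factor is at most its value at radius
  \<open>norm u + 1\<close>, because the power is monotone in its base for a nonnegative exponent.
\<close>

lemma continuous_on_of_locally_Lipschitz_rpow:
  fixes \<Psi> :: "'a::real_normed_vector \<Rightarrow> real"
  assumes "0 \<le> q" "0 \<le> L"
    and lip: "\<And>u v. \<bar>\<Psi> u - \<Psi> v\<bar>
      \<le> L * max 1 (max (rpow (norm u) q) (rpow (norm v) q)) * norm (u - v)"
  shows "continuous_on UNIV \<Psi>"
proof -
  have "isCont \<Psi> u" for u
  proof -
    define C where "C = L * max 1 (rpow (norm u + 1) q)"
    have mono: "rpow x q \<le> rpow y q" if "0 \<le> x" "x \<le> y" for x y
      using that \<open>0 \<le> q\<close> by (auto simp: rpow_def intro: powr_mono2)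
    have "\<bar>\<Psi> v - \<Psi> u\<bar> \<le> C * norm (v - u)" if "dist v u < 1" for v
    proof -
      have "norm v \<le> norm u + 1"
        using norm_triangle_sub[of v u] that by (simp add: dist_norm)
      then have "max 1 (max (rpow (norm v) q) (rpow (norm u) q)) \<le> max 1 (rpow (norm u + 1) q)"
        using mono[of "norm v" "norm u + 1"] mono[of "norm u" "norm u + 1"] by auto
      then have "L * max 1 (max (rpow (norm v) q) (rpow (norm u) q)) * norm (v - u) \<le> C * norm (v - u)"
        unfolding C_def using \<open>0 \<le> L\<close> by (intro mult_right_mono mult_left_mono) auto
      then show ?thesis using lip[of v u] by linarith
    qed
    then have "eventually (\<lambda>v. norm (\<Psi> v - \<Psi> u) \<le> C * norm (v - u)) (at u)"
      by (auto simp: eventually_at intro!: exI[of _ 1])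
    moreover have "((\<lambda>v. C * norm (v - u)) \<longlongrightarrow> 0) (at u)"
      by (auto intro!: tendsto_eq_intros)
    ultimately have "((\<lambda>v. \<Psi> v - \<Psi> u) \<longlongrightarrow> 0) (at u)"
      by (rule Lim_null_comparison)
    then show ?thesis by (simp add: isCont_def LIM_zero_iff)
  qed
  then show ?thesis by (simp add: continuous_at_imp_continuous_on)
qed

text \<open>
  Integrating out the additive noise first leaves a bounded, jointly continuous function of the
  starting point and the position, to which the coupling argument for \<open>K\<close> applies. This avoids
  building couplings of the proposals themselves.
\<close>

lemma continuous_on_integral_proposal:
  fixes K :: "'a::{banach, second_countable_topology} \<Rightarrow> 'a measure"
    and f :: "'a \<Rightarrow> 'a \<Rightarrow> real"
  assumes K: "\<And>u. prob_space (K u)" "\<And>u. sets (K u) = sets borel"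
    and \<Lambda>: "prob_space \<Lambda>" "sets \<Lambda> = sets borel"
    and W: "\<And>u v. coupling (W u v) (K u) (K v)"
    and close: "\<And>u v. AE (x, y) in W u v. dist x y \<le> dist u v"
    and cont: "continuous_on UNIV (\<lambda>(u, z). f u z)"
    and bound: "\<And>u z. \<bar>f u z\<bar> \<le> B"
  shows "continuous_on UNIV (\<lambda>u. \<integral>z. f u z \<partial>proposal K \<Lambda> u)"
proof -
  interpret L: prob_space \<Lambda> by fact
  have "continuous_on UNIV (f u)" for u
    using continuous_on_compose2[OF cont, of UNIV "\<lambda>x. (u, x)"]
    by (simp add: continuous_on_Pair)
  then have meas: "f u \<in> borel_measurable borel" for u
    by (rule borel_measurable_continuous_onI)
  have "\<bar>\<integral>\<xi>. f u (x + \<xi>) \<partial>\<Lambda>\<bar> \<le> B" for u x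
  proof -
    have "0 \<le> B" using bound[of u x] by linarith
    have m: "(\<lambda>\<xi>. f u (x + \<xi>)) \<in> borel_measurable \<Lambda>"
      using meas \<Lambda>(2) by measurable
    have i: "integrable \<Lambda> (\<lambda>\<xi>. f u (x + \<xi>))"
      using bound by (intro L.integrable_const_bound[of _ B] m) auto
    have "\<bar>\<integral>\<xi>. f u (x + \<xi>) \<partial>\<Lambda>\<bar> \<le> (\<integral>\<xi>. \<bar>f u (x + \<xi>)\<bar> \<partial>\<Lambda>)" by (rule integral_abs_bound)
    also have "\<dots> \<le> (\<integral>\<xi>. B \<partial>\<Lambda>)" using i bound by (intro integral_mono) auto
    finally show ?thesis by (simp add: L.prob_space)
  qed
  then have "continuous_on UNIV (\<lambda>u. \<integral>x. \<integral>\<xi>. f u (x + \<xi>) \<partial>\<Lambda> \<partial>K u)"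
    using W close L.finite_measure_axioms \<Lambda>(2) cont bound
    by (intro continuous_on_integral_nonexpansive_coupling continuous_on_integral_translate)
  then show ?thesis
    unfolding proposal_def using K \<Lambda> meas bound by (subst integral_conv[where B = B])
qed


theorem theorem3:
  fixes \<Psi> :: "'a::{banach, second_countable_topology} \<Rightarrow> real"
    and K :: "'a \<Rightarrow> 'a measure" and \<Lambda> :: "'a measure" and q :: real
  assumes "\<Psi> \<in> borel_measurable borel"
    and "K \<in> borel \<rightarrow>\<^sub>M prob_algebra borel"
    and "radon_prob \<Lambda>"
    and "q \<ge> 0"
    and A1a: "\<forall>R>0. \<exists>M1\<ge>0. \<forall>u\<in>cball 0 R. \<Psi> u \<le> M1"
    and A1b: "\<exists>M2\<ge>0. \<exists>M3\<ge>0. \<forall>u. \<Psi> u \<ge> M3 - M2 * ln (1 + rpow (norm u) q)"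
    and A1d: "\<exists>L>0. \<forall>u v. \<bar>\<Psi> u - \<Psi> v\<bar>
                \<le> L * max 1 (max (rpow (norm u) q) (rpow (norm v) q)) * norm (u - v)"
    and A2a: "\<forall>u. u \<noteq> 0 \<longrightarrow> (AE z in K u. norm z < norm u)" "AE z in K 0. z = 0"
    and A2c: "\<exists>\<beta>::real. 0 < \<beta> \<and> \<beta> < 1 \<and> (\<exists>W :: 'a \<Rightarrow> 'a \<Rightarrow> ('a \<times> 'a) measure.
                (\<forall>u v. coupling (W u v) (K u) (K v) \<and>
                   (u \<noteq> v \<longrightarrow> (AE (x, y) in W u v. norm (x - y) < norm (u - v))) \<and>
                   (u = v \<longrightarrow> (AE (x, y) in W u v. x = y))) \<and>
                (SUP (u, v)\<in>{(u, v). u \<noteq> v}.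
                   inverse (ennreal (norm (u - v))) * (\<integral>\<^sup>+(x, y). ennreal (norm (x - y)) \<partial>W u v))
                  \<le> ennreal \<beta>)"
    and A3: "(\<integral>\<^sup>+\<xi>. ennreal (rpow (norm \<xi>) q) \<partial>\<Lambda>) < \<infinity>"
  shows "feller (rcar_mh \<Psi> K \<Lambda>)"
proof -
  have K: "prob_space (K u)" "sets (K u) = sets borel" for u
    using measurable_space[OF \<open>K \<in> borel \<rightarrow>\<^sub>M prob_algebra borel\<close>, of u]
    by (auto simp: space_prob_algebra)
  have \<Lambda>: "prob_space \<Lambda>" "sets \<Lambda> = sets borel"
    using \<open>radon_prob \<Lambda>\<close> by (auto simp: radon_prob_def)
  have P: "prob_space (rcar_mh \<Psi> K \<Lambda> u)" for u
    by (rule prob_space_rcar_mh) fact+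
  have Q: "prob_space (proposal K \<Lambda> u)" for u
    unfolding proposal_def by (intro prob_space_conv K \<Lambda>)
  obtain W where "\<And>u v. coupling (W u v) (K u) (K v) \<and>
      (u \<noteq> v \<longrightarrow> (AE (x, y) in W u v. norm (x - y) < norm (u - v))) \<and>
      (u = v \<longrightarrow> (AE (x, y) in W u v. x = y))"
    using A2c by (elim exE conjE) (rule that, blast)
  then have W: "coupling (W u v) (K u) (K v)"
    and contract: "u \<noteq> v \<Longrightarrow> AE (x, y) in W u v. norm (x - y) < norm (u - v)"
    and diagonal: "AE (x, y) in W u u. x = y" for u v
    by blast+
  (* The two cases of the coupling assumption merge into one non-strict inequality. *)
  have close: "AE (x, y) in W u v. dist x y \<le> dist u v" for u v
  proof (cases "u = v")
    case True
    show ?thesis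
      using diagonal[of u] unfolding True by (rule AE_mp) auto
  next
    case False
    show ?thesis
      using contract[OF False] by (rule AE_mp) (auto simp: dist_norm)
  qed
  have "continuous_on UNIV \<Psi>"
    using A1d \<open>0 \<le> q\<close> by (metis continuous_on_of_locally_Lipschitz_rpow less_imp_le)
  then have "continuous_on UNIV (\<lambda>p. \<Psi> (fst p))" "continuous_on UNIV (\<lambda>p. \<Psi> (snd p))"
    by (rule continuous_on_compose2; auto intro: continuous_intros)+
  then have cont_accept: "continuous_on UNIV (\<lambda>(u, v). accept \<Psi> u v)"
    unfolding accept_def case_prod_beta by (intro continuous_intros)
  have "continuous_on UNIV (\<lambda>u. \<integral>v. \<phi> v \<partial>rcar_mh \<Psi> K \<Lambda> u)"
    if \<phi>: "continuous_on UNIV \<phi>" "bounded (range \<phi>)" for \<phi> :: "'a \<Rightarrow> real"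
  proof -
    obtain B where B: "\<bar>\<phi> v\<bar> \<le> B" for v
      using \<open>bounded (range \<phi>)\<close> by (auto simp: bounded_iff)
    have "continuous_on UNIV (\<lambda>p. \<phi> (snd p))"
      by (rule continuous_on_compose2[OF \<phi>(1)]) (auto intro: continuous_intros)
    with cont_accept have "continuous_on UNIV (\<lambda>(u, v). accept \<Psi> u v * \<phi> v)"
      unfolding case_prod_beta by (rule continuous_on_mult)
    moreover have "\<bar>accept \<Psi> u v * \<phi> v\<bar> \<le> 1 * B" for u v
      unfolding abs_mult using B by (intro mult_mono) (auto simp: accept_bounds)
    ultimately have "continuous_on UNIV (\<lambda>u. \<integral>v. accept \<Psi> u v * \<phi> v \<partial>proposal K \<Lambda> u)"
      by (rule continuous_on_integral_proposal[OF K \<Lambda> W close])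
    moreover have "continuous_on UNIV (\<lambda>u. \<integral>v. accept \<Psi> u v \<partial>proposal K \<Lambda> u)"
      by (rule continuous_on_integral_proposal[OF K \<Lambda> W close cont_accept, of 1])
        (simp add: accept_bounds)
    moreover have "(\<integral>v. \<phi> v \<partial>rcar_mh \<Psi> K \<Lambda> u) = (\<integral>v. accept \<Psi> u v * \<phi> v \<partial>proposal K \<Lambda> u)
        + \<phi> u * (1 - (\<integral>w. accept \<Psi> u w \<partial>proposal K \<Lambda> u))" for u
      using \<open>\<Psi> \<in> borel_measurable borel\<close> borel_measurable_continuous_onI[OF \<phi>(1)] Q P B
      by (rule integral_rcar_mh)
    ultimately show ?thesis
      using \<phi>(1) by (simp add: continuous_on_add continuous_on_mult continuous_on_diff)
  qed
  then show ?thesis by (auto simp: feller_def)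
qed

end
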